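(* Let $X$ be a complete uniformly locally bounded space. The group $\mathrm{ULB}(X)$ of all automorphisms of $X$, endowed with the topology of uniform biconvergence on bounded sets, is Raikov-complete.
   Context: For $E \subseteq X \times X$ and $B \subseteq X$, write $E[B] = \{y \mid \exists x \in B,\ (x,y) \in E\}$. Elements of a uniform structure are called uniform entourages. A bornology on a set $X$ is a collection of subsets of $X$ (called bounded sets) that contains all singletons, is stable under taking subsets, and is such that $A \cup B$ is bounded whenever $A, B$ are bounded and $A \cap B \neq \emptyset$. A uniformly locally bounded space is a set $X$ endowed with a uniform structure and a bornology such that there exists a uniform entourage $E$ for which $E[B]$ is bounded for every bounded set $B$. It is complete if every Cauchy net of its uniform structure is convergent. A morphism of uniformly locally bounded spaces is a map whose restriction to each bounded set is uniformly continuous and that sends bounded sets to bounded sets. $\mathrm{ULB}(X)$ is the group of bijections $\varphi : X \to X$ such that both $\varphi$ and $\varphi^{-1}$ are morphisms. The topology of uniform biconvergence on bounded sets on $\mathrm{ULB}(X)$ is the one in which a net $(g_i)$ converges to $g$ if and only if both $g_i \to g$ and $g_i^{-1} \to g^{-1}$ uniformly on each bounded set. It makes $\mathrm{ULB}(X)$ a topological group. A topological group $G$ is Raikov-complete if it is complete (every Cauchy net converges) for its upper uniform structure, i.e. the uniform structure generated by the entourages $\{(x,y) \mid xy^{-1} \in V,\ x^{-1}y \in V\}$, with $V$ running among identity neighborhoods of $G$.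
   Formalization: The space X is additionally assumed Hausdorff (and non-empty); without the Hausdorff condition the claim fails, e.g. for the real line with every rational point doubled and all subsets bounded. *)

theory Defs
  imports "HOL-Analysis.Analysis" "HOL-Algebra.Group"
begin

section \<open>Uniformly locally bounded spaces\<close>

text \<open>
  The underlying set is a type of class \<^class>\<open>uniform_space\<close>, so only the bornology is explicit.
  This class does not include the Hausdorff axiom. Completeness is to be understood for Hausdorff
  spaces, i.e. together with \<^class>\<open>t2_space\<close>: otherwise a limit of bijections need only be a
  bijection modulo indistinguishable points, and indistinguishability classes of different
  cardinality make \<open>ULB\<close> incomplete.
\<close>

text \<open>Only intersecting bounded sets are required to have a bounded union.\<close>

definition bornology :: "'a set set \<Rightarrow> bool" where
  "bornology \<B> \<longleftrightarrow>
     (\<forall>x. {x} \<in> \<B>) \<and>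
     (\<forall>B\<in>\<B>. \<forall>A. A \<subseteq> B \<longrightarrow> A \<in> \<B>) \<and>
     (\<forall>A\<in>\<B>. \<forall>B\<in>\<B>. A \<inter> B \<noteq> {} \<longrightarrow> A \<union> B \<in> \<B>)"

definition uniform_entourage :: "('a::uniform_space \<times> 'a) set \<Rightarrow> bool" where
  "uniform_entourage E \<longleftrightarrow> eventually (\<lambda>p. p \<in> E) uniformity"

definition uniformly_locally_bounded :: "'a::uniform_space set set \<Rightarrow> bool" where
  "uniformly_locally_bounded \<B> \<longleftrightarrow>
     bornology \<B> \<and> (\<exists>E. uniform_entourage E \<and> (\<forall>B\<in>\<B>. E `` B \<in> \<B>))"

definition ulb_morphism ::
  "'a::uniform_space set set \<Rightarrow> 'b::uniform_space set set \<Rightarrow> ('a \<Rightarrow> 'b) \<Rightarrow> bool" where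
  "ulb_morphism \<A> \<B> f \<longleftrightarrow> (\<forall>A\<in>\<A>. uniformly_continuous_on A f \<and> f ` A \<in> \<B>)"

definition ULB :: "'a::uniform_space set set \<Rightarrow> ('a \<Rightarrow> 'a) monoid" where
  "ULB \<B> = \<lparr> carrier = {\<phi>. bij \<phi> \<and> ulb_morphism \<B> \<B> \<phi> \<and> ulb_morphism \<B> \<B> (inv_into UNIV \<phi>)},
            mult = (\<circ>), one = id \<rparr>"


section \<open>Uniform biconvergence on bounded sets\<close>

text \<open>\<^const>\<open>uniform_limit\<close> is confined to metric spaces.\<close>

definition uniformly_converges_on ::
  "'x set \<Rightarrow> ('i \<Rightarrow> 'x \<Rightarrow> 'a::uniform_space) \<Rightarrow> ('x \<Rightarrow> 'a) \<Rightarrow> 'i filter \<Rightarrow> bool" where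
  "uniformly_converges_on B f g F \<longleftrightarrow>
     (\<forall>E. uniform_entourage E \<longrightarrow> (\<forall>\<^sub>F i in F. \<forall>x\<in>B. (f i x, g x) \<in> E))"

definition biconv_nbhd ::
  "'a::uniform_space set set \<Rightarrow> ('a \<times> 'a) set \<Rightarrow> 'a set set \<Rightarrow> ('a \<Rightarrow> 'a) \<Rightarrow> ('a \<Rightarrow> 'a) set" where
  "biconv_nbhd \<B> E \<C> g =
     {h \<in> carrier (ULB \<B>). \<forall>B\<in>\<C>. \<forall>x\<in>B.
        (h x, g x) \<in> E \<and> (inv_into UNIV h x, inv_into UNIV g x) \<in> E}"

text \<open>
  Finite families of bounded sets are needed here because a bornology need not be directed.
  The description of this topology by convergence is \<open>limitin_ULB_topology\<close> below.
\<close>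

definition ULB_topology :: "'a::uniform_space set set \<Rightarrow> ('a \<Rightarrow> 'a) topology" where
  "ULB_topology \<B> = topology (\<lambda>U. U \<subseteq> carrier (ULB \<B>) \<and>
     (\<forall>g\<in>U. \<exists>E \<C>. uniform_entourage E \<and> finite \<C> \<and> \<C> \<subseteq> \<B> \<and> biconv_nbhd \<B> E \<C> g \<subseteq> U))"


section \<open>Raikov-completeness\<close>

definition topological_group :: "('g, 'm) monoid_scheme \<Rightarrow> 'g topology \<Rightarrow> bool" where
  "topological_group G T \<longleftrightarrow>
     group G \<and> topspace T = carrier G \<and>
     continuous_map (prod_topology T T) T (\<lambda>(x, y). x \<otimes>\<^bsub>G\<^esub> y) \<and>
     continuous_map T T (\<lambda>x. inv\<^bsub>G\<^esub> x)"

definition upper_uniformity :: "('g, 'm) monoid_scheme \<Rightarrow> 'g topology \<Rightarrow> ('g \<times> 'g) filter" where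
  "upper_uniformity G T =
     (INF V\<in>{V. eventually (\<lambda>x. x \<in> V) (nhdsin T \<one>\<^bsub>G\<^esub>)}.
        principal {(x, y) \<in> carrier G \<times> carrier G.
          x \<otimes>\<^bsub>G\<^esub> inv\<^bsub>G\<^esub> y \<in> V \<and> inv\<^bsub>G\<^esub> x \<otimes>\<^bsub>G\<^esub> y \<in> V})"

text \<open>
  As in the definitions of \<^const>\<open>cauchy_filter\<close> and \<^const>\<open>complete\<close>, proper filters play the
  role of nets; \<open>raikov_complete_net\<close> below is the version for nets with any index type.
\<close>

definition raikov_complete :: "('g, 'm) monoid_scheme \<Rightarrow> 'g topology \<Rightarrow> bool" where
  "raikov_complete G T \<longleftrightarrow>
     topological_group G T \<and>
     (\<forall>F \<le> principal (carrier G). F \<noteq> bot \<longrightarrow> F \<times>\<^sub>F F \<le> upper_uniformity G T \<longrightarrow>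
        (\<exists>g\<in>carrier G. limitin T (\<lambda>x. x) g F))"


section \<open>Basic facts\<close>

lemma raikov_complete_net:
  fixes f :: "'i \<Rightarrow> 'g"
  assumes "raikov_complete G T" "F \<noteq> bot" "\<forall>\<^sub>F i in F. f i \<in> carrier G"
    and "\<And>V. eventually (\<lambda>x. x \<in> V) (nhdsin T \<one>\<^bsub>G\<^esub>) \<Longrightarrow>
      \<forall>\<^sub>F (i, j) in F \<times>\<^sub>F F. f i \<otimes>\<^bsub>G\<^esub> inv\<^bsub>G\<^esub> (f j) \<in> V \<and> inv\<^bsub>G\<^esub> (f i) \<otimes>\<^bsub>G\<^esub> f j \<in> V"
  shows "\<exists>g\<in>carrier G. limitin T f g F"
proof -
  have "filtermap f F \<le> principal (carrier G)"
    using assms(3) by (simp add: le_principal eventually_filtermap)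
  moreover have "filtermap f F \<noteq> bot"
    using assms(2) by (simp add: filtermap_bot_iff)
  moreover have "filtermap f F \<times>\<^sub>F filtermap f F \<le> upper_uniformity G T"
    unfolding upper_uniformity_def
  proof (rule INF_greatest)
    fix V assume "V \<in> {V. eventually (\<lambda>x. x \<in> V) (nhdsin T \<one>\<^bsub>G\<^esub>)}"
    then have "\<forall>\<^sub>F (i, j) in F \<times>\<^sub>F F.
        f i \<otimes>\<^bsub>G\<^esub> inv\<^bsub>G\<^esub> (f j) \<in> V \<and> inv\<^bsub>G\<^esub> (f i) \<otimes>\<^bsub>G\<^esub> f j \<in> V"
      using assms(4) by auto
    moreover have "\<forall>\<^sub>F (i, j) in F \<times>\<^sub>F F. f i \<in> carrier G \<and> f j \<in> carrier G"
      using assms(3) by (auto simp: eventually_prod_filter)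
    ultimately have "\<forall>\<^sub>F p in F \<times>\<^sub>F F. (f (fst p), f (snd p)) \<in> {(x, y) \<in> carrier G \<times> carrier G.
          x \<otimes>\<^bsub>G\<^esub> inv\<^bsub>G\<^esub> y \<in> V \<and> inv\<^bsub>G\<^esub> x \<otimes>\<^bsub>G\<^esub> y \<in> V}"
      by eventually_elim auto
    then show "filtermap f F \<times>\<^sub>F filtermap f F \<le> principal {(x, y) \<in> carrier G \<times> carrier G.
          x \<otimes>\<^bsub>G\<^esub> inv\<^bsub>G\<^esub> y \<in> V \<and> inv\<^bsub>G\<^esub> x \<otimes>\<^bsub>G\<^esub> y \<in> V}"
      by (simp add: le_principal prod_filtermap1 prod_filtermap2 eventually_filtermap
          case_prod_unfold)
  qed
  ultimately obtain g where "g \<in> carrier G" "limitin T (\<lambda>x. x) g (filtermap f F)"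
    using assms(1) unfolding raikov_complete_def by blast
  then show ?thesis
    by (auto simp: limitin_def eventually_filtermap)
qed

lemma uniform_entourage_Int:
  "uniform_entourage D \<Longrightarrow> uniform_entourage E \<Longrightarrow> uniform_entourage (D \<inter> E)"
  by (simp add: uniform_entourage_def eventually_conj_iff)

lemma uniform_entourage_UNIV: "uniform_entourage UNIV"
  by (simp add: uniform_entourage_def)

lemma uniform_entourage_refl: "uniform_entourage E \<Longrightarrow> (x, x) \<in> E"
  unfolding uniform_entourage_def by (rule uniformity_refl)

lemma uniform_entourage_trans:
  assumes "uniform_entourage E"
  obtains D where "uniform_entourage D"
    "\<And>x y z. (x, y) \<in> D \<Longrightarrow> (y, z) \<in> D \<Longrightarrow> (x, z) \<in> E"
proof -
  from uniformity_trans[OF assms[unfolded uniform_entourage_def]] obtain P where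
    "eventually P uniformity" "\<And>x y z. P (x, y) \<Longrightarrow> P (y, z) \<Longrightarrow> (x, z) \<in> E" by blast
  then show thesis
    by (intro that[of "{p. P p}"]) (auto simp: uniform_entourage_def)
qed

lemma openin_ULB_topology:
  "openin (ULB_topology \<B>) U \<longleftrightarrow> U \<subseteq> carrier (ULB \<B>) \<and>
     (\<forall>g\<in>U. \<exists>E \<C>. uniform_entourage E \<and> finite \<C> \<and> \<C> \<subseteq> \<B> \<and> biconv_nbhd \<B> E \<C> g \<subseteq> U)"
proof -
  let ?P = "\<lambda>U. U \<subseteq> carrier (ULB \<B>) \<and>
     (\<forall>g\<in>U. \<exists>E \<C>. uniform_entourage E \<and> finite \<C> \<and> \<C> \<subseteq> \<B> \<and> biconv_nbhd \<B> E \<C> g \<subseteq> U)"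
  have "istopology ?P"
    unfolding istopology_def
  proof (intro conjI allI impI)
    fix S T assume S: "?P S" and T: "?P T"
    show "S \<inter> T \<subseteq> carrier (ULB \<B>)" using S by blast
    show "\<forall>g\<in>S \<inter> T. \<exists>E \<C>. uniform_entourage E \<and> finite \<C> \<and> \<C> \<subseteq> \<B> \<and> biconv_nbhd \<B> E \<C> g \<subseteq> S \<inter> T"
    proof
      fix g assume g: "g \<in> S \<inter> T"
      obtain E1 C1 where 1: "uniform_entourage E1" "finite C1" "C1 \<subseteq> \<B>" "biconv_nbhd \<B> E1 C1 g \<subseteq> S"
        using S g by blast
      obtain E2 C2 where 2: "uniform_entourage E2" "finite C2" "C2 \<subseteq> \<B>" "biconv_nbhd \<B> E2 C2 g \<subseteq> T"
        using T g by blast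
      have "biconv_nbhd \<B> (E1 \<inter> E2) (C1 \<union> C2) g \<subseteq> biconv_nbhd \<B> E1 C1 g \<inter> biconv_nbhd \<B> E2 C2 g"
        by (auto simp: biconv_nbhd_def)
      then show "\<exists>E \<C>. uniform_entourage E \<and> finite \<C> \<and> \<C> \<subseteq> \<B> \<and> biconv_nbhd \<B> E \<C> g \<subseteq> S \<inter> T"
        using 1 2 by (intro exI[of _ "E1 \<inter> E2"] exI[of _ "C1 \<union> C2"]) (auto intro: uniform_entourage_Int)
    qed
  next
    fix \<K> assume K: "\<forall>K\<in>\<K>. ?P K"
    then show "\<Union>\<K> \<subseteq> carrier (ULB \<B>)" by blast
    show "\<forall>g\<in>\<Union>\<K>. \<exists>E \<C>. uniform_entourage E \<and> finite \<C> \<and> \<C> \<subseteq> \<B> \<and> biconv_nbhd \<B> E \<C> g \<subseteq> \<Union>\<K>"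
    proof
      fix g assume "g \<in> \<Union>\<K>"
      then obtain K where g: "K \<in> \<K>" "g \<in> K" by (rule UnionE)
      have "\<exists>E \<C>. uniform_entourage E \<and> finite \<C> \<and> \<C> \<subseteq> \<B> \<and> biconv_nbhd \<B> E \<C> g \<subseteq> K"
        by (rule bspec[OF conjunct2[OF bspec[OF K g(1)]] g(2)])
      then obtain E \<C> where "uniform_entourage E" "finite \<C>" "\<C> \<subseteq> \<B>"
        "biconv_nbhd \<B> E \<C> g \<subseteq> K" by (elim exE conjE)
      then show "\<exists>E \<C>. uniform_entourage E \<and> finite \<C> \<and> \<C> \<subseteq> \<B> \<and> biconv_nbhd \<B> E \<C> g \<subseteq> \<Union>\<K>"
        using g(1) by (intro exI[of _ E] exI[of _ \<C>]) auto
    qed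
  qed
  then show ?thesis
    by (simp add: ULB_topology_def topology_inverse')
qed

lemma topspace_ULB_topology: "topspace (ULB_topology \<B>) = carrier (ULB \<B>)"
proof -
  have "openin (ULB_topology \<B>) (carrier (ULB \<B>))"
    unfolding openin_ULB_topology
  proof (intro conjI ballI)
    fix g assume "g \<in> carrier (ULB \<B>)"
    show "\<exists>E \<C>. uniform_entourage E \<and> finite \<C> \<and> \<C> \<subseteq> \<B> \<and> biconv_nbhd \<B> E \<C> g \<subseteq> carrier (ULB \<B>)"
      by (rule exI[of _ UNIV], rule exI[of _ "{}"]) (auto simp: uniform_entourage_UNIV biconv_nbhd_def)
  qed simp
  then have "carrier (ULB \<B>) \<subseteq> topspace (ULB_topology \<B>)" by (rule openin_subset)
  moreover have "topspace (ULB_topology \<B>) \<subseteq> carrier (ULB \<B>)"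
    by (rule conjunct1[OF iffD1[OF openin_ULB_topology openin_topspace]])
  ultimately show ?thesis by (rule equalityI[rotated])
qed

text \<open>A net converges in this topology iff it and its inverses converge uniformly on bounded sets.\<close>

lemma limitin_ULB_topology:
  "limitin (ULB_topology \<B>) f g F \<longleftrightarrow>
     g \<in> carrier (ULB \<B>) \<and> (\<forall>\<^sub>F i in F. f i \<in> carrier (ULB \<B>)) \<and>
     (\<forall>B\<in>\<B>. uniformly_converges_on B f g F \<and>
        uniformly_converges_on B (\<lambda>i. inv_into UNIV (f i)) (inv_into UNIV g) F)"
    (is "?L \<longleftrightarrow> ?R")
proof
  assume L: ?L
  have g: "g \<in> carrier (ULB \<B>)"
    using L by (simp add: limitin_def topspace_ULB_topology)
  have car: "\<forall>\<^sub>F i in F. f i \<in> carrier (ULB \<B>)"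
    using L openin_topspace[of "ULB_topology \<B>"] g
    unfolding limitin_def topspace_ULB_topology by blast
  have near: "\<forall>\<^sub>F i in F. f i \<in> biconv_nbhd \<B> E {B} g" if B: "B \<in> \<B>" and E: "uniform_entourage E" for B E
  proof -
    let ?U = "{h \<in> carrier (ULB \<B>). \<exists>D. uniform_entourage D \<and> biconv_nbhd \<B> D {B} h \<subseteq> biconv_nbhd \<B> E {B} g}"
    have "openin (ULB_topology \<B>) ?U"
      unfolding openin_ULB_topology
    proof (intro conjI ballI)
      fix h assume "h \<in> ?U"
      then obtain D where D: "uniform_entourage D" "biconv_nbhd \<B> D {B} h \<subseteq> biconv_nbhd \<B> E {B} g" by blast
      obtain D' where D': "uniform_entourage D'" "\<And>x y z. (x, y) \<in> D' \<Longrightarrow> (y, z) \<in> D' \<Longrightarrow> (x, z) \<in> D"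
        using uniform_entourage_trans[OF D(1)] by blast
      have "biconv_nbhd \<B> D' {B} h \<subseteq> ?U"
      proof
        fix k assume k: "k \<in> biconv_nbhd \<B> D' {B} h"
        have "l \<in> biconv_nbhd \<B> D {B} h" if l: "l \<in> biconv_nbhd \<B> D' {B} k" for l
        proof -
          have "(l x, h x) \<in> D \<and> (inv_into UNIV l x, inv_into UNIV h x) \<in> D" if "x \<in> B" for x
            using that k l D'(2)[of "l x" "k x" "h x"]
              D'(2)[of "inv_into UNIV l x" "inv_into UNIV k x" "inv_into UNIV h x"]
            by (simp add: biconv_nbhd_def)
          then show ?thesis using l by (simp add: biconv_nbhd_def)
        qed
        then have "biconv_nbhd \<B> D' {B} k \<subseteq> biconv_nbhd \<B> E {B} g" using D(2) by (meson subset_iff)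
        moreover have "k \<in> carrier (ULB \<B>)" using k by (simp add: biconv_nbhd_def)
        ultimately show "k \<in> ?U" using D'(1) by (intro CollectI conjI exI[of _ D'])
      qed
      then show "\<exists>E \<C>. uniform_entourage E \<and> finite \<C> \<and> \<C> \<subseteq> \<B> \<and> biconv_nbhd \<B> E \<C> h \<subseteq> ?U"
        using D'(1) B by (intro exI[of _ D'] exI[of _ "{B}"]) auto
    qed auto
    moreover have "g \<in> ?U" using g E by blast
    moreover have "\<forall>U. openin (ULB_topology \<B>) U \<and> g \<in> U \<longrightarrow> (\<forall>\<^sub>F i in F. f i \<in> U)"
      using L unfolding limitin_def by (rule conjunct2)
    ultimately have "\<forall>\<^sub>F i in F. f i \<in> ?U" by (elim allE[of _ ?U] impE) (rule conjI)
    then show ?thesis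
    proof eventually_elim
      case (elim i)
      then obtain D where "f i \<in> carrier (ULB \<B>)" "uniform_entourage D"
        "biconv_nbhd \<B> D {B} (f i) \<subseteq> biconv_nbhd \<B> E {B} g" by blast
      moreover have "f i \<in> biconv_nbhd \<B> D {B} (f i)"
        using calculation by (auto simp: biconv_nbhd_def uniform_entourage_refl)
      ultimately show ?case by blast
    qed
  qed
  have "uniformly_converges_on B f g F \<and>
        uniformly_converges_on B (\<lambda>i. inv_into UNIV (f i)) (inv_into UNIV g) F" if B: "B \<in> \<B>" for B
    unfolding uniformly_converges_on_def
  proof (intro conjI allI impI)
    fix E :: "('a \<times> 'a) set" assume E: "uniform_entourage E"
    show "\<forall>\<^sub>F i in F. \<forall>x\<in>B. (f i x, g x) \<in> E"
      using near[OF B E] by eventually_elim (auto simp: biconv_nbhd_def)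
    show "\<forall>\<^sub>F i in F. \<forall>x\<in>B. (inv_into UNIV (f i) x, inv_into UNIV g x) \<in> E"
      using near[OF B E] by eventually_elim (auto simp: biconv_nbhd_def)
  qed
  then show ?R using g car by blast
next
  assume R: ?R
  show ?L
    unfolding limitin_def
  proof (intro conjI allI impI)
    show "g \<in> topspace (ULB_topology \<B>)" using R by (simp add: topspace_ULB_topology)
    fix U assume U: "openin (ULB_topology \<B>) U \<and> g \<in> U"
    then obtain E \<C> where E: "uniform_entourage E" "finite \<C>" "\<C> \<subseteq> \<B>" "biconv_nbhd \<B> E \<C> g \<subseteq> U"
      unfolding openin_ULB_topology by blast
    have "\<forall>\<^sub>F i in F. \<forall>B\<in>\<C>. (\<forall>x\<in>B. (f i x, g x) \<in> E) \<and>
        (\<forall>x\<in>B. (inv_into UNIV (f i) x, inv_into UNIV g x) \<in> E)"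
    proof (intro eventually_ball_finite[OF E(2)] ballI eventually_conj)
      fix B assume "B \<in> \<C>"
      with E(3) R have "uniformly_converges_on B f g F"
        "uniformly_converges_on B (\<lambda>i. inv_into UNIV (f i)) (inv_into UNIV g) F" by auto
      then show "\<forall>\<^sub>F i in F. \<forall>x\<in>B. (f i x, g x) \<in> E"
        "\<forall>\<^sub>F i in F. \<forall>x\<in>B. (inv_into UNIV (f i) x, inv_into UNIV g x) \<in> E"
        using E(1) by (simp_all add: uniformly_converges_on_def)
    qed
    moreover have "\<forall>\<^sub>F i in F. f i \<in> carrier (ULB \<B>)" using R by blast
    ultimately show "\<forall>\<^sub>F i in F. f i \<in> U"
    proof eventually_elim
      case (elim i)
      then have "f i \<in> biconv_nbhd \<B> E \<C> g" by (auto simp: biconv_nbhd_def)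
      then show ?case using E(4) by blast
    qed
  qed
qed

end

theory Submission
  imports Defs
begin

text \<open>
  A Cauchy filter \<open>F\<close> for the upper uniformity provides two families of maps, its members \<open>f\<close> and
  their inverses, and the argument treats them in the same way: each family converges uniformly on
  every bounded set, the two limits are morphisms, and they are inverse to each other.

  The delicate point is that the Cauchy condition compares \<open>f \<circ> f'\<^sup>-\<^sup>1\<close> with the identity on sets that
  do not depend on \<open>f'\<close>, whereas one wants to compare \<open>f\<close> with \<open>f'\<close> on a bounded set \<open>A\<close>, that is,
  \<open>f \<circ> f'\<^sup>-\<^sup>1\<close> with the identity on \<open>f' ` A\<close>. The other half of the condition helps: let \<open>E\<close> be the
  entourage that thickens bounded sets to bounded sets, and fix a late member \<open>k\<close> of the filter. As
  \<open>k\<^sup>-\<^sup>1 \<circ> f'\<close> is \<open>E\<close>-close to the identity on \<open>A\<close>, all late \<open>f'\<close> map \<open>A\<close> into the single set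
  \<open>k ` (E-thickening of A)\<close>, which is bounded because \<open>k\<close> is a morphism
  (\<open>raikov_cauchy_eventually_into_bounded\<close>). On this set the first half applies, so the filter is
  uniformly Cauchy on \<open>A\<close> (\<open>raikov_cauchy_imp_uniformly_cauchy\<close>), and completeness of the space
  yields a limit (\<open>uniformly_cauchy_imp_uniformly_convergent\<close>).

  The limit is uniformly continuous on bounded sets as a uniform limit, and it preserves
  boundedness because its values on \<open>A\<close> are \<open>E\<close>-close to those of some member of the filter.
  Composition is compatible with uniform convergence on bounded sets
  (\<open>uniformly_converges_on_compose\<close>), again because convergent maps eventually send a bounded set
  into a thickening of its limit image. This fact gives continuity of the multiplication, and it
  also shows that the limits of \<open>f\<close> and \<open>f\<^sup>-\<^sup>1\<close> compose to the limit of \<open>f \<circ> f\<^sup>-\<^sup>1 = id\<close>, so that by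
  the Hausdorff property they are mutually inverse.
\<close>

section \<open>Entourages and uniform convergence\<close>

lemma uniform_entourage_converse:
  "uniform_entourage E \<Longrightarrow> uniform_entourage (E\<inverse>)"
  unfolding uniform_entourage_def
  by (drule uniformity_sym) (auto elim!: eventually_mono)

lemma uniform_entourage_eventually_nhds:
  assumes "uniform_entourage E"
  shows "\<forall>\<^sub>F y in nhds x. (y, x) \<in> E"
  using uniform_entourage_converse[OF assms]
  unfolding uniform_entourage_def eventually_nhds_uniformity
  by eventually_elim auto

text \<open>
  Three links suffice for comparing two values of a limit through two values of an approximating
  map; symmetry spares attention to the order of the pairs.
\<close>

lemma uniform_entourage_third:
  assumes "uniform_entourage E"
  obtains D where "uniform_entourage D" "sym D" "D O D O D \<subseteq> E"
proof -
  obtain D1 where D1: "uniform_entourage D1"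
    "\<And>x y z. (x, y) \<in> D1 \<Longrightarrow> (y, z) \<in> D1 \<Longrightarrow> (x, z) \<in> E"
    using uniform_entourage_trans[OF assms] by blast
  obtain D2 where D2: "uniform_entourage D2"
    "\<And>x y z. (x, y) \<in> D2 \<Longrightarrow> (y, z) \<in> D2 \<Longrightarrow> (x, z) \<in> D1"
    using uniform_entourage_trans[OF D1(1)] by blast
  let ?D = "D2 \<inter> D2\<inverse>"
  have sub: "D2 \<subseteq> D1"
    using D2(2)[OF _ uniform_entourage_refl[OF D2(1)]] by auto
  show thesis
  proof (rule that[of ?D])
    show "uniform_entourage ?D"
      by (intro uniform_entourage_Int uniform_entourage_converse D2(1))
    show "sym ?D" by (auto intro: symI)
    show "?D O ?D O ?D \<subseteq> E"
    proof
      fix p assume "p \<in> ?D O ?D O ?D"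
      then obtain w x y z where p: "p = (w, z)" "(w, x) \<in> D2" "(x, y) \<in> D2" "(y, z) \<in> D2"
        by auto
      have "(w, y) \<in> D1" by (rule D2(2)[OF p(2,3)])
      moreover have "(y, z) \<in> D1" using p(4) sub by blast
      ultimately show "p \<in> E" unfolding p(1) by (rule D1(2))
    qed
  qed
qed

lemma uniformly_continuous_on_entourage:
  "uniformly_continuous_on A f \<longleftrightarrow>
     (\<forall>E. uniform_entourage E \<longrightarrow>
        (\<exists>D. uniform_entourage D \<and> (\<forall>x\<in>A. \<forall>y\<in>A. (x, y) \<in> D \<longrightarrow> (f x, f y) \<in> E)))"
proof (intro iffI allI impI)
  fix E assume "uniformly_continuous_on A f" "uniform_entourage (E :: ('b \<times> 'b) set)"
  then have "eventually (\<lambda>(x, y). x \<in> A \<longrightarrow> y \<in> A \<longrightarrow> (f x, f y) \<in> E) uniformity"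
    unfolding uniform_entourage_def by (rule uniformly_continuous_onD)
  then show "\<exists>D. uniform_entourage D \<and> (\<forall>x\<in>A. \<forall>y\<in>A. (x, y) \<in> D \<longrightarrow> (f x, f y) \<in> E)"
    by (intro exI[of _ "{(x, y). x \<in> A \<longrightarrow> y \<in> A \<longrightarrow> (f x, f y) \<in> E}"])
      (auto simp: uniform_entourage_def case_prod_unfold)
next
  assume R: "\<forall>E. uniform_entourage E \<longrightarrow>
    (\<exists>D. uniform_entourage D \<and> (\<forall>x\<in>A. \<forall>y\<in>A. (x, y) \<in> D \<longrightarrow> (f x, f y) \<in> E))"
  show "uniformly_continuous_on A f"
    unfolding uniformly_continuous_on_uniformity filterlim_iff
  proof (intro allI impI)
    fix P :: "'b \<times> 'b \<Rightarrow> bool" assume "eventually P uniformity"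
    then have "uniform_entourage {p. P p}" by (simp add: uniform_entourage_def)
    then obtain D where "uniform_entourage D"
      and D: "\<forall>x\<in>A. \<forall>y\<in>A. (x, y) \<in> D \<longrightarrow> P (f x, f y)" using R by blast
    then have "\<forall>\<^sub>F p in uniformity. p \<in> D" by (simp add: uniform_entourage_def)
    then show "\<forall>\<^sub>F p in uniformity_on A. P (case p of (x, y) \<Rightarrow> (f x, f y))"
      unfolding eventually_inf_principal by eventually_elim (use D in auto)
  qed
qed

lemma uniformly_converges_onD:
  "uniformly_converges_on A f g F \<Longrightarrow> uniform_entourage E \<Longrightarrow>
     \<forall>\<^sub>F i in F. \<forall>x\<in>A. (f i x, g x) \<in> E"
  by (simp add: uniformly_converges_on_def)

lemma uniform_limit_uniformly_continuous_on:
  fixes f :: "'i \<Rightarrow> 'a::uniform_space \<Rightarrow> 'b::uniform_space"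
  assumes "F \<noteq> bot" "\<forall>\<^sub>F i in F. uniformly_continuous_on A (f i)"
    and "uniformly_converges_on A f g F"
  shows "uniformly_continuous_on A g"
  unfolding uniformly_continuous_on_entourage
proof (intro allI impI)
  fix E :: "('b \<times> 'b) set" assume "uniform_entourage E"
  then obtain D where D: "uniform_entourage D" "sym D" "D O D O D \<subseteq> E"
    by (rule uniform_entourage_third)
  have "\<forall>\<^sub>F i in F. uniformly_continuous_on A (f i) \<and> (\<forall>x\<in>A. (f i x, g x) \<in> D)"
    using assms(2) uniformly_converges_onD[OF assms(3) D(1)] by (rule eventually_conj)
  then obtain i where i: "uniformly_continuous_on A (f i)" "\<forall>x\<in>A. (f i x, g x) \<in> D"
    using eventually_happens'[OF assms(1)] by blast
  then obtain D' where "uniform_entourage D'"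
    "\<forall>x\<in>A. \<forall>y\<in>A. (x, y) \<in> D' \<longrightarrow> (f i x, f i y) \<in> D"
    using D(1) unfolding uniformly_continuous_on_entourage by blast
  moreover have "(g x, g y) \<in> E" if "x \<in> A" "y \<in> A" "(f i x, f i y) \<in> D" for x y
    using that i(2) D(2,3) by (blast dest: symD)
  ultimately show "\<exists>D. uniform_entourage D \<and> (\<forall>x\<in>A. \<forall>y\<in>A. (x, y) \<in> D \<longrightarrow> (g x, g y) \<in> E)"
    by blast
qed

lemma uniformly_converges_on_unique:
  fixes g h :: "'x \<Rightarrow> 'a::{uniform_space, t2_space}"
  assumes "F \<noteq> bot" "uniformly_converges_on A f g F" "uniformly_converges_on A f h F" "x \<in> A"
  shows "g x = h x"
proof -
  have tendsto: "((\<lambda>i. f i x) \<longlongrightarrow> l x) F" if l: "uniformly_converges_on A f l F" for l :: "'x \<Rightarrow> 'a"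
    unfolding tendsto_def
  proof (intro allI impI)
    fix S assume "open S" "l x \<in> S"
    then have "\<forall>\<^sub>F y in nhds (l x). y \<in> S" by (simp add: eventually_nhds_in_open)
    then have "uniform_entourage ({(x', y). x' = l x \<longrightarrow> y \<in> S})"
      by (simp add: eventually_nhds_uniformity uniform_entourage_def case_prod_unfold)
    then have "\<forall>\<^sub>F i in F. \<forall>z\<in>A. (f i z, l z) \<in> ({(x', y). x' = l x \<longrightarrow> y \<in> S})\<inverse>"
      by (rule uniformly_converges_onD[OF l uniform_entourage_converse])
    then show "\<forall>\<^sub>F i in F. f i x \<in> S" by eventually_elim (use assms(4) in auto)
  qed
  show ?thesis
    by (rule tendsto_unique[OF assms(1) tendsto[OF assms(2)] tendsto[OF assms(3)]])
qed

text \<open>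
  Completeness supplies the limit at each point. The convergence is as uniform as the Cauchy
  condition, because in the latter one of the two indices can be sent to the limit.
\<close>

lemma uniformly_cauchy_imp_uniformly_convergent:
  fixes f :: "'i \<Rightarrow> 'x \<Rightarrow> 'a::uniform_space"
  assumes complete: "complete (UNIV :: 'a set)" and F: "F \<noteq> bot"
    and cauchy: "\<And>A E. A \<in> \<S> \<Longrightarrow> uniform_entourage E \<Longrightarrow>
      \<forall>\<^sub>F (i, j) in F \<times>\<^sub>F F. \<forall>a\<in>A. (f i a, f j a) \<in> E"
    and cover: "\<Union>\<S> = UNIV"
  obtains g where "\<And>A. A \<in> \<S> \<Longrightarrow> uniformly_converges_on A f g F"
proof -
  have "\<exists>l. filterlim (\<lambda>i. f i x) (nhds l) F" for x
  proof -
    have "x \<in> \<Union>\<S>" by (simp add: cover)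
    then obtain A where A: "A \<in> \<S>" "x \<in> A" by (rule UnionE)
    have "cauchy_filter (filtermap (\<lambda>i. f i x) F)"
      unfolding cauchy_filter_def le_filter_def
    proof (intro allI impI)
      fix P :: "'a \<times> 'a \<Rightarrow> bool" assume "eventually P uniformity"
      then have "uniform_entourage {p. P p}" by (simp add: uniform_entourage_def)
      from cauchy[OF A(1) this]
      have "\<forall>\<^sub>F (i, j) in F \<times>\<^sub>F F. P (f i x, f j x)"
        by eventually_elim (use A(2) in auto)
      then show "eventually P (filtermap (\<lambda>i. f i x) F \<times>\<^sub>F filtermap (\<lambda>i. f i x) F)"
        by (simp add: prod_filtermap1 prod_filtermap2 eventually_filtermap case_prod_unfold)
    qed
    moreover have "filtermap (\<lambda>i. f i x) F \<noteq> bot" using F by (simp add: filtermap_bot_iff)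
    ultimately show ?thesis
      using complete unfolding complete_uniform filterlim_def by auto
  qed
  then obtain g where g: "\<And>x. filterlim (\<lambda>i. f i x) (nhds (g x)) F" by metis
  have "uniformly_converges_on A f g F" if A: "A \<in> \<S>" for A
    unfolding uniformly_converges_on_def
  proof (intro allI impI)
    fix E :: "('a \<times> 'a) set" assume "uniform_entourage E"
    then obtain D where D: "uniform_entourage D"
      "\<And>x y z. (x, y) \<in> D \<Longrightarrow> (y, z) \<in> D \<Longrightarrow> (x, z) \<in> E"
      using uniform_entourage_trans by blast
    obtain Q where Q: "eventually Q F" "\<And>i j a. Q i \<Longrightarrow> Q j \<Longrightarrow> a \<in> A \<Longrightarrow> (f i a, f j a) \<in> D"
      using cauchy[OF A D(1)] unfolding eventually_prod_same by auto
    show "\<forall>\<^sub>F i in F. \<forall>a\<in>A. (f i a, g a) \<in> E"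
      using Q(1)
    proof eventually_elim
      case (elim i)
      show ?case
      proof
        fix a assume a: "a \<in> A"
        have "\<forall>\<^sub>F j in F. (f j a, g a) \<in> D"
          by (rule eventually_compose_filterlim[OF uniform_entourage_eventually_nhds[OF D(1)] g])
        with Q(1) have "\<forall>\<^sub>F j in F. Q j \<and> (f j a, g a) \<in> D" by (rule eventually_conj)
        then obtain j where "Q j" "(f j a, g a) \<in> D" using eventually_happens'[OF F] by blast
        then show "(f i a, g a) \<in> E" using D(2)[OF Q(2)[OF elim _ a]] by blast
      qed
    qed
  qed
  then show thesis by (rule that)
qed


section \<open>Thickening bounded sets\<close>

lemma bornologyD:
  assumes "bornology \<B>"
  shows "{x} \<in> \<B>" "B \<in> \<B> \<Longrightarrow> A \<subseteq> B \<Longrightarrow> A \<in> \<B>"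
  using assms by (auto simp: bornology_def)

text \<open>
  Shrinking an entourage shrinks the thickenings, so it may be taken to be symmetric.
\<close>

lemma uniformly_locally_bounded_thickening:
  assumes "uniformly_locally_bounded \<B>"
  obtains E where "uniform_entourage E" "sym E" "\<And>B. B \<in> \<B> \<Longrightarrow> E `` B \<in> \<B>"
proof -
  obtain E where E: "uniform_entourage E" "\<forall>B\<in>\<B>. E `` B \<in> \<B>" and \<B>: "bornology \<B>"
    using assms by (auto simp: uniformly_locally_bounded_def)
  show thesis
  proof (rule that[of "E \<inter> E\<inverse>"])
    show "uniform_entourage (E \<inter> E\<inverse>)"
      by (intro uniform_entourage_Int uniform_entourage_converse E(1))
    show "(E \<inter> E\<inverse>) `` B \<in> \<B>" if "B \<in> \<B>" for B
      by (rule bornologyD(2)[OF \<B> bspec[OF E(2) that]]) auto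
  qed (auto intro: symI)
qed

lemma limit_image_bounded:
  assumes "uniformly_locally_bounded \<B>" "F \<noteq> bot" "\<forall>\<^sub>F i in F. f i ` A \<in> \<B>"
    and "uniformly_converges_on A f g F"
  shows "g ` A \<in> \<B>"
proof -
  obtain E where E: "uniform_entourage E" "\<And>B. B \<in> \<B> \<Longrightarrow> E `` B \<in> \<B>"
    using uniformly_locally_bounded_thickening[OF assms(1)] by blast
  have "\<forall>\<^sub>F i in F. f i ` A \<in> \<B> \<and> (\<forall>x\<in>A. (f i x, g x) \<in> E)"
    using assms(3) uniformly_converges_onD[OF assms(4) E(1)] by (rule eventually_conj)
  then obtain i where i: "f i ` A \<in> \<B>" "\<forall>x\<in>A. (f i x, g x) \<in> E"
    using eventually_happens'[OF assms(2)] by blast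
  have "bornology \<B>" using assms(1) by (simp add: uniformly_locally_bounded_def)
  then show ?thesis
    by (rule bornologyD(2)[OF _ E(2)[OF i(1)]]) (use i(2) in blast)
qed

text \<open>
  The values \<open>f' i x\<close> with \<open>x \<in> A\<close> eventually stay in a thickening \<open>C\<close> of \<open>g' ` A\<close>. On \<open>C\<close>, the maps
  \<open>f i\<close> are uniformly close to \<open>g\<close>, and \<open>g\<close> is uniformly continuous.
\<close>

lemma uniformly_converges_on_compose:
  fixes f :: "'i \<Rightarrow> 'a::uniform_space \<Rightarrow> 'b::uniform_space" and f' :: "'i \<Rightarrow> 'x \<Rightarrow> 'a"
  assumes ulb: "uniformly_locally_bounded \<B>"
    and f: "\<And>B. B \<in> \<B> \<Longrightarrow> uniformly_converges_on B f g F"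
    and f': "uniformly_converges_on A f' g' F"
    and g: "\<And>B. B \<in> \<B> \<Longrightarrow> uniformly_continuous_on B g"
    and g': "g' ` A \<in> \<B>"
  shows "uniformly_converges_on A (\<lambda>i. f i \<circ> f' i) (g \<circ> g') F"
  unfolding uniformly_converges_on_def
proof (intro allI impI)
  fix E :: "('b \<times> 'b) set" assume "uniform_entourage E"
  then obtain D where D: "uniform_entourage D"
    "\<And>x y z. (x, y) \<in> D \<Longrightarrow> (y, z) \<in> D \<Longrightarrow> (x, z) \<in> E"
    using uniform_entourage_trans by blast
  obtain T where T: "uniform_entourage T" "sym T" "\<And>B. B \<in> \<B> \<Longrightarrow> T `` B \<in> \<B>"
    using uniformly_locally_bounded_thickening[OF ulb] by blast
  let ?C = "T `` (g' ` A)"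
  have C: "?C \<in> \<B>" by (rule T(3)[OF g'])
  obtain S where S: "uniform_entourage S" "\<And>x y. x \<in> ?C \<Longrightarrow> y \<in> ?C \<Longrightarrow> (x, y) \<in> S \<Longrightarrow> (g x, g y) \<in> D"
    using g[OF C] D(1) unfolding uniformly_continuous_on_entourage by meson
  have "\<forall>\<^sub>F i in F. \<forall>x\<in>A. (f' i x, g' x) \<in> S \<inter> T"
    by (rule uniformly_converges_onD[OF f' uniform_entourage_Int[OF S(1) T(1)]])
  with uniformly_converges_onD[OF f[OF C] D(1)]
  show "\<forall>\<^sub>F i in F. \<forall>x\<in>A. ((f i \<circ> f' i) x, (g \<circ> g') x) \<in> E"
  proof eventually_elim
    case (elim i)
    show ?case
    proof
      fix x assume x: "x \<in> A"
      have f'x: "f' i x \<in> ?C" using elim(2) x T(2) by (blast dest: symD)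
      have g'x: "g' x \<in> ?C" using uniform_entourage_refl[OF T(1)] x by blast
      have "(f i (f' i x), g (f' i x)) \<in> D" using elim(1) f'x by blast
      moreover have "(g (f' i x), g (g' x)) \<in> D" using S(2)[OF f'x g'x] elim(2) x by blast
      ultimately show "((f i \<circ> f' i) x, (g \<circ> g') x) \<in> E" using D(2)[of "f i (f' i x)"] by auto
    qed
  qed
qed


section \<open>The topological group of automorphisms\<close>

lemma carrier_ULB_iff:
  "\<phi> \<in> carrier (ULB \<B>) \<longleftrightarrow>
     bij \<phi> \<and> ulb_morphism \<B> \<B> \<phi> \<and> ulb_morphism \<B> \<B> (inv_into UNIV \<phi>)"
  by (simp add: ULB_def)

lemma ulb_morphism_compose:
  assumes "ulb_morphism \<A> \<B> f" "ulb_morphism \<B> \<C> g"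
  shows "ulb_morphism \<A> \<C> (g \<circ> f)"
  unfolding ulb_morphism_def
proof (intro ballI conjI)
  fix A assume "A \<in> \<A>"
  then have f: "uniformly_continuous_on A f" "f ` A \<in> \<B>"
    using assms(1) by (auto simp: ulb_morphism_def)
  then have g: "uniformly_continuous_on (f ` A) g" "g ` (f ` A) \<in> \<C>"
    using assms(2) by (auto simp: ulb_morphism_def)
  show "uniformly_continuous_on A (g \<circ> f)"
    using uniformly_continuous_on_compose[OF f(1) g(1)] by (simp add: comp_def)
  show "(g \<circ> f) ` A \<in> \<C>" using g(2) by (simp add: image_comp)
qed

lemma compose_in_ULB:
  assumes "f \<in> carrier (ULB \<B>)" "g \<in> carrier (ULB \<B>)"
  shows "f \<circ> g \<in> carrier (ULB \<B>)"
  using assms by (auto simp: carrier_ULB_iff bij_comp o_inv_distrib intro: ulb_morphism_compose)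

lemma inv_into_in_ULB:
  "f \<in> carrier (ULB \<B>) \<Longrightarrow> inv_into UNIV f \<in> carrier (ULB \<B>)"
  by (simp add: carrier_ULB_iff bij_imp_bij_inv inv_inv_eq)

lemma id_in_ULB: "id \<in> carrier (ULB \<B>)"
  by (auto simp: carrier_ULB_iff ulb_morphism_def uniformly_continuous_on_entourage)

lemma group_ULB: "group (ULB \<B>)"
proof (rule groupI)
  fix f assume f: "f \<in> carrier (ULB \<B>)"
  then have "inv_into UNIV f \<circ> f = id" by (simp add: carrier_ULB_iff bij_is_inj)
  then show "\<exists>g\<in>carrier (ULB \<B>). g \<otimes>\<^bsub>ULB \<B>\<^esub> f = \<one>\<^bsub>ULB \<B>\<^esub>"
    using inv_into_in_ULB[OF f] by (auto simp: ULB_def)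
next
  show "f \<otimes>\<^bsub>ULB \<B>\<^esub> g \<in> carrier (ULB \<B>)" if "f \<in> carrier (ULB \<B>)" "g \<in> carrier (ULB \<B>)" for f g
    using compose_in_ULB[OF that] by (simp add: ULB_def)
  show "\<one>\<^bsub>ULB \<B>\<^esub> \<in> carrier (ULB \<B>)"
    using id_in_ULB[of \<B>] by (simp add: ULB_def)
qed (auto simp: ULB_def)

lemma inv_ULB:
  assumes "f \<in> carrier (ULB \<B>)"
  shows "inv\<^bsub>ULB \<B>\<^esub> f = inv_into UNIV f"
proof (rule group.inv_equality[OF group_ULB _ assms inv_into_in_ULB[OF assms]])
  have "inv_into UNIV f \<circ> f = id" using assms by (simp add: carrier_ULB_iff bij_is_inj)
  then show "inv_into UNIV f \<otimes>\<^bsub>ULB \<B>\<^esub> f = \<one>\<^bsub>ULB \<B>\<^esub>" by (simp add: ULB_def)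
qed

lemma limitin_ULB_inverse:
  assumes "limitin (ULB_topology \<B>) f g F"
  shows "limitin (ULB_topology \<B>) (\<lambda>i. inv_into UNIV (f i)) (inv_into UNIV g) F"
proof -
  have f: "\<forall>\<^sub>F i in F. f i \<in> carrier (ULB \<B>)" and g: "g \<in> carrier (ULB \<B>)"
    using assms by (auto simp: limitin_ULB_topology)
  have inv_inv: "inv_into UNIV (inv_into UNIV h) = h" if "h \<in> carrier (ULB \<B>)" for h
    using that by (simp add: carrier_ULB_iff inv_inv_eq)
  have "uniformly_converges_on B (\<lambda>i. inv_into UNIV (inv_into UNIV (f i))) g F"
    if "uniformly_converges_on B f g F" for B
    unfolding uniformly_converges_on_def
  proof (intro allI impI)
    fix E :: "('a \<times> 'a) set" assume "uniform_entourage E"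
    with that have "\<forall>\<^sub>F i in F. \<forall>x\<in>B. (f i x, g x) \<in> E" by (rule uniformly_converges_onD)
    with f show "\<forall>\<^sub>F i in F. \<forall>x\<in>B. (inv_into UNIV (inv_into UNIV (f i)) x, g x) \<in> E"
      by eventually_elim (simp add: inv_inv)
  qed
  moreover have "\<forall>\<^sub>F i in F. inv_into UNIV (f i) \<in> carrier (ULB \<B>)"
    using f by eventually_elim (rule inv_into_in_ULB)
  ultimately show ?thesis
    using assms inv_into_in_ULB[OF g] by (simp add: limitin_ULB_topology inv_inv[OF g])
qed

lemma limitin_ULB_compose:
  assumes ulb: "uniformly_locally_bounded \<B>"
    and f: "limitin (ULB_topology \<B>) f g F" and f': "limitin (ULB_topology \<B>) f' g' F"
  shows "limitin (ULB_topology \<B>) (\<lambda>i. f i \<circ> f' i) (g \<circ> g') F"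
proof -
  have compose: "uniformly_converges_on B (\<lambda>i. h i \<circ> h' i) (k \<circ> k') F"
    if "limitin (ULB_topology \<B>) h k F" "limitin (ULB_topology \<B>) h' k' F" "B \<in> \<B>" for h h' k k' B
    using that
    by (intro uniformly_converges_on_compose[OF ulb])
      (auto simp: limitin_ULB_topology carrier_ULB_iff ulb_morphism_def)
  have car: "\<forall>\<^sub>F i in F. f i \<in> carrier (ULB \<B>)" "\<forall>\<^sub>F i in F. f' i \<in> carrier (ULB \<B>)"
    "g \<in> carrier (ULB \<B>)" "g' \<in> carrier (ULB \<B>)"
    using f f' by (auto simp: limitin_ULB_topology)
  have inv: "inv_into UNIV (h \<circ> h') = inv_into UNIV h' \<circ> inv_into UNIV h"
    if "h \<in> carrier (ULB \<B>)" "h' \<in> carrier (ULB \<B>)" for h h'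
    using that by (simp add: carrier_ULB_iff o_inv_distrib)
  have "uniformly_converges_on B (\<lambda>i. inv_into UNIV (f i \<circ> f' i)) (inv_into UNIV (g \<circ> g')) F"
    if B: "B \<in> \<B>" for B
    unfolding uniformly_converges_on_def
  proof (intro allI impI)
    fix E :: "('a \<times> 'a) set" assume "uniform_entourage E"
    then have "\<forall>\<^sub>F i in F. \<forall>x\<in>B.
      ((inv_into UNIV (f' i) \<circ> inv_into UNIV (f i)) x, (inv_into UNIV g' \<circ> inv_into UNIV g) x) \<in> E"
      by (rule uniformly_converges_onD[OF
            compose[OF limitin_ULB_inverse[OF f'] limitin_ULB_inverse[OF f] B]])
    with car(1,2)
    show "\<forall>\<^sub>F i in F. \<forall>x\<in>B. (inv_into UNIV (f i \<circ> f' i) x, inv_into UNIV (g \<circ> g') x) \<in> E"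
      by eventually_elim (simp add: inv car(3,4))
  qed
  moreover have "\<forall>\<^sub>F i in F. f i \<circ> f' i \<in> carrier (ULB \<B>)"
    using car(1,2) by eventually_elim (rule compose_in_ULB)
  ultimately show ?thesis
    using compose[OF f f'] compose_in_ULB[OF car(3,4)] by (simp add: limitin_ULB_topology)
qed

lemma topological_group_ULB:
  assumes "uniformly_locally_bounded \<B>"
  shows "topological_group (ULB \<B>) (ULB_topology \<B>)"
proof -
  let ?T = "ULB_topology \<B>"
  have "continuous_map (prod_topology ?T ?T) ?T (\<lambda>(x, y). x \<circ> y)"
    unfolding continuous_map_atin
  proof
    fix p assume p: "p \<in> topspace (prod_topology ?T ?T)"
    have "limitin ?T (\<lambda>p. fst p \<circ> snd p) (fst p \<circ> snd p) (atin (prod_topology ?T ?T) p)"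
      by (intro limitin_ULB_compose[OF assms] limitin_continuous_map[OF _ p]
          continuous_map_fst continuous_map_snd refl)
    then show "limitin ?T (\<lambda>(x, y). x \<circ> y) (case p of (x, y) \<Rightarrow> x \<circ> y) (atin (prod_topology ?T ?T) p)"
      by (simp add: case_prod_unfold)
  qed
  moreover have "continuous_map ?T ?T (\<lambda>x. inv_into UNIV x)"
    unfolding continuous_map_atin
    by (intro ballI limitin_ULB_inverse) (auto intro: limitin_continuous_map)
  then have "continuous_map ?T ?T (\<lambda>x. inv\<^bsub>ULB \<B>\<^esub> x)"
    by (rule continuous_map_eq) (simp add: topspace_ULB_topology inv_ULB)
  ultimately show ?thesis
    by (simp add: topological_group_def group_ULB topspace_ULB_topology)
      (simp add: ULB_def)
qed


section \<open>Cauchy families of automorphisms\<close>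

text \<open>
  The Cauchy condition of the upper uniformity, tested on single bounded sets. In this form it is
  visibly invariant under passage to the inverses.
\<close>

definition raikov_cauchy :: "'a::uniform_space set set \<Rightarrow> ('i \<Rightarrow> 'a \<Rightarrow> 'a) \<Rightarrow> 'i filter \<Rightarrow> bool" where
  "raikov_cauchy \<B> f F \<longleftrightarrow>
     (\<forall>A\<in>\<B>. \<forall>E. uniform_entourage E \<longrightarrow> (\<forall>\<^sub>F (i, j) in F \<times>\<^sub>F F. \<forall>a\<in>A.
        (f i (inv_into UNIV (f j) a), a) \<in> E \<and> (inv_into UNIV (f i) (f j a), a) \<in> E))"

lemma raikov_cauchyE:
  assumes "raikov_cauchy \<B> f F" "\<forall>\<^sub>F i in F. f i \<in> carrier (ULB \<B>)" "A \<in> \<B>" "uniform_entourage E"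
  obtains Q where "eventually Q F" "\<And>i. Q i \<Longrightarrow> f i \<in> carrier (ULB \<B>)"
    "\<And>i j a. Q i \<Longrightarrow> Q j \<Longrightarrow> a \<in> A \<Longrightarrow> (f i (inv_into UNIV (f j) a), a) \<in> E"
    "\<And>i j a. Q i \<Longrightarrow> Q j \<Longrightarrow> a \<in> A \<Longrightarrow> (inv_into UNIV (f i) (f j a), a) \<in> E"
proof -
  obtain Q where "eventually Q F" "\<forall>i j. Q i \<longrightarrow> Q j \<longrightarrow> (\<forall>a\<in>A.
      (f i (inv_into UNIV (f j) a), a) \<in> E \<and> (inv_into UNIV (f i) (f j a), a) \<in> E)"
    using assms(1,3,4) unfolding raikov_cauchy_def eventually_prod_same by force
  then show thesis
    using eventually_conj[OF _ assms(2)] by (intro that[of "\<lambda>i. Q i \<and> f i \<in> carrier (ULB \<B>)"]) auto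
qed

lemma raikov_cauchy_inverse:
  fixes \<B> :: "'a::uniform_space set set"
  assumes "raikov_cauchy \<B> f F" "\<forall>\<^sub>F i in F. f i \<in> carrier (ULB \<B>)"
  shows "raikov_cauchy \<B> (\<lambda>i. inv_into UNIV (f i)) F"
  unfolding raikov_cauchy_def
proof (intro ballI allI impI)
  fix A and E :: "('a \<times> 'a) set" assume "A \<in> \<B>" "uniform_entourage E"
  then obtain Q where Q: "eventually Q F" "\<And>i. Q i \<Longrightarrow> f i \<in> carrier (ULB \<B>)"
    "\<And>i j a. Q i \<Longrightarrow> Q j \<Longrightarrow> a \<in> A \<Longrightarrow> (f i (inv_into UNIV (f j) a), a) \<in> E"
    "\<And>i j a. Q i \<Longrightarrow> Q j \<Longrightarrow> a \<in> A \<Longrightarrow> (inv_into UNIV (f i) (f j a), a) \<in> E"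
    using raikov_cauchyE[OF assms] by metis
  have "inv_into UNIV (inv_into UNIV (f i)) = f i" if "Q i" for i
    using Q(2)[OF that] by (simp add: carrier_ULB_iff inv_inv_eq)
  with Q show "\<forall>\<^sub>F (i, j) in F \<times>\<^sub>F F. \<forall>a\<in>A.
      (inv_into UNIV (f i) (inv_into UNIV (inv_into UNIV (f j)) a), a) \<in> E \<and>
      (inv_into UNIV (inv_into UNIV (f i)) (inv_into UNIV (f j) a), a) \<in> E"
    unfolding eventually_prod_same by (intro exI[of _ Q]) simp
qed

text \<open>
  The bounded set is the image, under one fixed late member \<open>f k\<close>, of a thickening of \<open>A\<close>: for late
  \<open>i\<close>, the map \<open>(f k)\<^sup>-\<^sup>1 \<circ> f i\<close> moves the points of \<open>A\<close> only within this thickening.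
\<close>

lemma raikov_cauchy_eventually_into_bounded:
  assumes "uniformly_locally_bounded \<B>" "F \<noteq> bot"
    and "raikov_cauchy \<B> f F" "\<forall>\<^sub>F i in F. f i \<in> carrier (ULB \<B>)" "A \<in> \<B>"
  obtains B where "B \<in> \<B>" "\<forall>\<^sub>F i in F. f i ` A \<subseteq> B"
proof -
  obtain T where T: "uniform_entourage T" "sym T" "\<And>B. B \<in> \<B> \<Longrightarrow> T `` B \<in> \<B>"
    using uniformly_locally_bounded_thickening[OF assms(1)] by blast
  obtain Q where Q: "eventually Q F" "\<And>i. Q i \<Longrightarrow> f i \<in> carrier (ULB \<B>)"
    "\<And>i j a. Q i \<Longrightarrow> Q j \<Longrightarrow> a \<in> A \<Longrightarrow> (inv_into UNIV (f i) (f j a), a) \<in> T"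
    using raikov_cauchyE[OF assms(3-5) T(1)] by metis
  obtain k where k: "Q k" using eventually_happens'[OF assms(2) Q(1)] by blast
  show thesis
  proof (rule that[of "f k ` (T `` A)"])
    show "f k ` (T `` A) \<in> \<B>"
      using Q(2)[OF k] T(3)[OF assms(5)] by (simp add: carrier_ULB_iff ulb_morphism_def)
    show "\<forall>\<^sub>F i in F. f i ` A \<subseteq> f k ` (T `` A)"
      using Q(1)
    proof eventually_elim
      case (elim i)
      have "f i a \<in> f k ` (T `` A)" if "a \<in> A" for a
      proof
        show "f i a = f k (inv_into UNIV (f k) (f i a))"
          using Q(2)[OF k] by (simp add: carrier_ULB_iff bij_is_surj surj_f_inv_f)
        show "inv_into UNIV (f k) (f i a) \<in> T `` A"
          using symD[OF T(2) Q(3)[OF k elim that]] that by blast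
      qed
      then show ?case by blast
    qed
  qed
qed

text \<open>
  Write \<open>f i a = (f i \<circ> (f j)\<^sup>-\<^sup>1) (f j a)\<close>, where \<open>f j a\<close> lies in a bounded set independent of \<open>j\<close>.
\<close>

lemma raikov_cauchy_imp_uniformly_cauchy:
  assumes ulb: "uniformly_locally_bounded \<B>" and F: "F \<noteq> bot"
    and f: "raikov_cauchy \<B> f F" "\<forall>\<^sub>F i in F. f i \<in> carrier (ULB \<B>)"
    and A: "A \<in> \<B>" and E: "uniform_entourage E"
  shows "\<forall>\<^sub>F (i, j) in F \<times>\<^sub>F F. \<forall>a\<in>A. (f i a, f j a) \<in> E"
proof -
  obtain B where B: "B \<in> \<B>" "\<forall>\<^sub>F i in F. f i ` A \<subseteq> B"
    using raikov_cauchy_eventually_into_bounded[OF ulb F f A] .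
  obtain Q where Q: "eventually Q F" "\<And>i. Q i \<Longrightarrow> f i \<in> carrier (ULB \<B>)"
    "\<And>i j b. Q i \<Longrightarrow> Q j \<Longrightarrow> b \<in> B \<Longrightarrow> (f i (inv_into UNIV (f j) b), b) \<in> E"
    using raikov_cauchyE[OF f B(1) E] by metis
  have "(f i a, f j a) \<in> E" if "Q i" "Q j" "f j ` A \<subseteq> B" "a \<in> A" for i j a
  proof -
    have "inv_into UNIV (f j) (f j a) = a"
      using Q(2)[OF that(2)] by (simp add: carrier_ULB_iff bij_is_inj)
    then show ?thesis using Q(3)[OF that(1,2), of "f j a"] that(3,4) by auto
  qed
  then show ?thesis
    using eventually_conj[OF Q(1) B(2)] unfolding eventually_prod_same
    by (intro exI[of _ "\<lambda>i. Q i \<and> f i ` A \<subseteq> B"]) auto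
qed

lemma raikov_cauchy_convergent:
  fixes \<B> :: "'a::uniform_space set set"
  assumes ulb: "uniformly_locally_bounded \<B>" and "complete (UNIV :: 'a set)" and F: "F \<noteq> bot"
    and f: "raikov_cauchy \<B> f F" "\<forall>\<^sub>F i in F. f i \<in> carrier (ULB \<B>)"
  obtains g where "ulb_morphism \<B> \<B> g" "\<And>B. B \<in> \<B> \<Longrightarrow> uniformly_converges_on B f g F"
proof -
  have "\<Union>\<B> = UNIV"
    using ulb by (auto simp: uniformly_locally_bounded_def bornology_def)
  then obtain g where g: "\<And>B. B \<in> \<B> \<Longrightarrow> uniformly_converges_on B f g F"
    using uniformly_cauchy_imp_uniformly_convergent[OF assms(2) F
        raikov_cauchy_imp_uniformly_cauchy[OF ulb F f]] by metis
  have "ulb_morphism \<B> \<B> g"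
    unfolding ulb_morphism_def
  proof (intro ballI conjI)
    fix A assume A: "A \<in> \<B>"
    have "\<forall>\<^sub>F i in F. uniformly_continuous_on A (f i)" "\<forall>\<^sub>F i in F. f i ` A \<in> \<B>"
      using f(2) by (eventually_elim; use A in \<open>simp add: carrier_ULB_iff ulb_morphism_def\<close>)+
    then show "uniformly_continuous_on A g" "g ` A \<in> \<B>"
      using uniform_limit_uniformly_continuous_on[OF F _ g[OF A]]
        limit_image_bounded[OF ulb F _ g[OF A]] by blast+
  qed
  then show thesis using g by (rule that)
qed

text \<open>
  Both \<open>g \<circ> h\<close> and \<open>id\<close> are limits of \<open>f \<circ> f'\<close> on bounded sets, in particular on points.
\<close>

lemma limits_of_inverses_compose_to_id:
  fixes \<B> :: "'a::{uniform_space, t2_space} set set"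
  assumes ulb: "uniformly_locally_bounded \<B>" and F: "F \<noteq> bot"
    and f: "\<And>B. B \<in> \<B> \<Longrightarrow> uniformly_converges_on B f g F"
    and f': "\<And>B. B \<in> \<B> \<Longrightarrow> uniformly_converges_on B f' h F"
    and "ulb_morphism \<B> \<B> g" "ulb_morphism \<B> \<B> h"
    and inverse: "\<forall>\<^sub>F i in F. f i \<circ> f' i = id"
  shows "g \<circ> h = id"
proof
  fix x
  have x: "{x} \<in> \<B>"
    using ulb by (auto simp: uniformly_locally_bounded_def bornology_def)
  have "uniformly_converges_on {x} (\<lambda>i. f i \<circ> f' i) (g \<circ> h) F"
    using assms(5,6) x
    by (intro uniformly_converges_on_compose[OF ulb f f'[OF x]]) (auto simp: ulb_morphism_def)
  moreover have "uniformly_converges_on {x} (\<lambda>i. f i \<circ> f' i) id F"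
    unfolding uniformly_converges_on_def
  proof (intro allI impI)
    fix E :: "('a \<times> 'a) set" assume E: "uniform_entourage E"
    show "\<forall>\<^sub>F i in F. \<forall>y\<in>{x}. ((f i \<circ> f' i) y, id y) \<in> E"
      using inverse by eventually_elim (simp only: uniform_entourage_refl[OF E] ball_simps simp_thms)
  qed
  ultimately show "(g \<circ> h) x = id x"
    by (rule uniformly_converges_on_unique[OF F]) simp
qed

lemma raikov_cauchy_limitin_ULB:
  fixes \<B> :: "'a::{uniform_space, t2_space} set set"
  assumes ulb: "uniformly_locally_bounded \<B>" and complete: "complete (UNIV :: 'a set)"
    and F: "F \<noteq> bot" and f: "raikov_cauchy \<B> f F" "\<forall>\<^sub>F i in F. f i \<in> carrier (ULB \<B>)"
  shows "\<exists>g\<in>carrier (ULB \<B>). limitin (ULB_topology \<B>) f g F"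
proof -
  have inv_car: "\<forall>\<^sub>F i in F. inv_into UNIV (f i) \<in> carrier (ULB \<B>)"
    using f(2) by eventually_elim (rule inv_into_in_ULB)
  obtain g where g: "ulb_morphism \<B> \<B> g" "\<And>B. B \<in> \<B> \<Longrightarrow> uniformly_converges_on B f g F"
    using raikov_cauchy_convergent[OF ulb complete F f] by blast
  obtain h where h: "ulb_morphism \<B> \<B> h"
    "\<And>B. B \<in> \<B> \<Longrightarrow> uniformly_converges_on B (\<lambda>i. inv_into UNIV (f i)) h F"
    using raikov_cauchy_convergent[OF ulb complete F raikov_cauchy_inverse[OF f] inv_car] by blast
  have "\<forall>\<^sub>F i in F. f i \<circ> inv_into UNIV (f i) = id" "\<forall>\<^sub>F i in F. inv_into UNIV (f i) \<circ> f i = id"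
    using f(2) by (eventually_elim; simp add: carrier_ULB_iff bij_is_inj bij_is_surj surj_iff[symmetric])+
  then have "g \<circ> h = id" "h \<circ> g = id"
    using limits_of_inverses_compose_to_id[OF ulb F g(2) h(2) g(1) h(1)]
      limits_of_inverses_compose_to_id[OF ulb F h(2) g(2) h(1) g(1)] by blast+
  then have "bij g" "inv_into UNIV g = h"
    by (auto intro: o_bij inv_unique_comp)
  then have "g \<in> carrier (ULB \<B>)" using g(1) h(1) by (simp add: carrier_ULB_iff)
  then show ?thesis
    using f(2) g(2) h(2) \<open>inv_into UNIV g = h\<close> by (auto simp: limitin_ULB_topology)
qed

text \<open>
  The neighbourhood filter of the identity converges to the identity, so by the description of
  convergence the automorphisms that are \<open>E\<close>-close to \<open>id\<close> on \<open>A\<close> form an identity neighbourhood.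
\<close>

lemma cauchy_upper_uniformity_imp_raikov_cauchy:
  assumes F: "F \<times>\<^sub>F F \<le> upper_uniformity (ULB \<B>) (ULB_topology \<B>)"
  shows "raikov_cauchy \<B> (\<lambda>x. x) F"
  unfolding raikov_cauchy_def
proof (intro ballI allI impI)
  fix A E assume A: "A \<in> \<B>" and E: "uniform_entourage (E :: ('a \<times> 'a) set)"
  let ?G = "ULB \<B>" and ?T = "ULB_topology \<B>"
  let ?V = "{x. \<forall>a\<in>A. (x a, a) \<in> E}"
  have "limitin ?T (\<lambda>x. x) id (nhdsin ?T id)"
    using id_in_ULB[of \<B>] by (auto simp: limitin_def topspace_ULB_topology eventually_nhdsin)
  then have "uniformly_converges_on A (\<lambda>x. x) id (nhdsin ?T id)"
    using A by (simp add: limitin_ULB_topology)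
  from uniformly_converges_onD[OF this E] have V: "\<forall>\<^sub>F x in nhdsin ?T \<one>\<^bsub>?G\<^esub>. x \<in> ?V"
    by (simp add: ULB_def)
  let ?U = "{(x, y) \<in> carrier ?G \<times> carrier ?G.
    x \<otimes>\<^bsub>?G\<^esub> inv\<^bsub>?G\<^esub> y \<in> ?V \<and> inv\<^bsub>?G\<^esub> x \<otimes>\<^bsub>?G\<^esub> y \<in> ?V}"
  have "upper_uniformity ?G ?T \<le> principal ?U"
    unfolding upper_uniformity_def by (rule INF_lower) (use V in simp)
  with F have "\<forall>\<^sub>F p in F \<times>\<^sub>F F. p \<in> ?U"
    using le_principal order.trans by blast
  then show "\<forall>\<^sub>F (x, y) in F \<times>\<^sub>F F. \<forall>a\<in>A.
      (x (inv_into UNIV y a), a) \<in> E \<and> (inv_into UNIV x (y a), a) \<in> E"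
    by eventually_elim (auto simp: inv_ULB, auto simp: ULB_def)
qed

theorem theorem2p16:
  fixes \<B> :: "'a::{uniform_space, t2_space} set set"
  assumes "uniformly_locally_bounded \<B>"
    and "complete (UNIV :: 'a set)"
  shows "raikov_complete (ULB \<B>) (ULB_topology \<B>)"
  unfolding raikov_complete_def
proof (intro conjI allI impI)
  show "topological_group (ULB \<B>) (ULB_topology \<B>)"
    by (rule topological_group_ULB[OF assms(1)])
next
  fix F assume F: "F \<le> principal (carrier (ULB \<B>))" "F \<noteq> bot"
    "F \<times>\<^sub>F F \<le> upper_uniformity (ULB \<B>) (ULB_topology \<B>)"
  have "\<forall>\<^sub>F x in F. x \<in> carrier (ULB \<B>)" using F(1) by (simp add: le_principal)
  then show "\<exists>g\<in>carrier (ULB \<B>). limitin (ULB_topology \<B>) (\<lambda>x. x) g F"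
    by (rule raikov_cauchy_limitin_ULB[OF assms F(2)
          cauchy_upper_uniformity_imp_raikov_cauchy[OF F(3)]])
qed

end
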